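(* Let $\mathcal{A}$ be a finite alphabet. For each $m,n\ge2$ and arbitrary sets $X_0,X_1,\dots,X_{mn-1}\subseteq\mathcal{A}^{\mathbb{N}}$, one has the identity of sets $$(\circledast_n)_{i=0}^{n-1}\Big((\circledast_m)_{j=0}^{m-1}X_{i+jn}\Big)=(\circledast_{mn})_{k=0}^{mn-1}X_k.$$
   Context: $\mathbb{N}=\{0,1,2,\dots\}$. For $n\ge1$, the $n$-fold interleaving of sequences $\mathbf{x}_i=a_{i,0}a_{i,1}a_{i,2}\cdots\in\mathcal{A}^{\mathbb{N}}$ ($0\le i\le n-1$) is the sequence $b_0b_1b_2\cdots$ with $b_{i+jn}=a_{i,j}$ for $0\le i\le n-1$, $j\ge0$. The $n$-fold interleaving $(\circledast_n)_{i=0}^{n-1}X_i$ of sets $X_0,\dots,X_{n-1}\subseteq\mathcal{A}^{\mathbb{N}}$ (in this order) is the set of all $n$-fold interleavings of $(\mathbf{x}_0,\dots,\mathbf{x}_{n-1})$ with $\mathbf{x}_i\in X_i$ for all $i$. *)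

theory Defs
  imports Main "HOL-Library.FuncSet"
begin

text \<open>
  Sequences are functions \<open>nat \<Rightarrow> 'a\<close>; the sequences over an alphabet \<open>A\<close> form the
  function space \<open>UNIV \<rightarrow> A\<close>. A family indexed by \<open>0, ..., n - 1\<close> is a function on \<open>nat\<close>
  of which only the values below \<open>n\<close> are used.
\<close>

definition is_interleaving :: "nat \<Rightarrow> (nat \<Rightarrow> nat \<Rightarrow> 'a) \<Rightarrow> (nat \<Rightarrow> 'a) \<Rightarrow> bool" where
  "is_interleaving n a b \<longleftrightarrow> (\<forall>i<n. \<forall>j. b (i + j * n) = a i j)"

definition interleaving :: "nat \<Rightarrow> (nat \<Rightarrow> (nat \<Rightarrow> 'a) set) \<Rightarrow> (nat \<Rightarrow> 'a) set" where
  "interleaving n X = {b. \<exists>x. (\<forall>i<n. x i \<in> X i) \<and> is_interleaving n x b}"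

text \<open>
  For \<open>n \<ge> 1\<close> the equations in \<^const>\<open>is_interleaving\<close> determine exactly one sequence. (For
  \<open>n = 0\<close>, which is outside the intended range, they are void.)
\<close>

lemma is_interleaving_iff:
  assumes "n \<ge> 1"
  shows "is_interleaving n a b \<longleftrightarrow> b = (\<lambda>k. a (k mod n) (k div n))"
proof
  assume *: "is_interleaving n a b"
  show "b = (\<lambda>k. a (k mod n) (k div n))"
  proof
    fix k
    have "b (k mod n + k div n * n) = a (k mod n) (k div n)"
      using * assms unfolding is_interleaving_def by (metis mod_less_divisor One_nat_def Suc_le_lessD)
    then show "b k = a (k mod n) (k div n)"
      by (simp only: mod_div_mult_eq)
  qed
next
  assume "b = (\<lambda>k. a (k mod n) (k div n))"
  then show "is_interleaving n a b"
    using assms by (simp add: is_interleaving_def)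
qed

end

theory Submission
  imports Defs
begin

text \<open>A sequence lies in an interleaving iff its subsequence along each residue class mod
  \<open>n\<close> lies in the matching set (\<open>mem_interleaving_iff\<close>). Nesting splits
  the class of \<open>i\<close> mod \<open>n\<close> into the classes of \<open>i + j * n\<close>
  mod \<open>m * n\<close>. These indices run through all \<open>k < m * n\<close>
  (\<open>all_less_mult_iff\<close>), so both sides impose the same conditions on
  \<open>b\<close>.\<close>

text \<open>The components of an interleaving can be read off from it, which removes the existential
  over \<open>x\<close>.\<close>

lemma mem_interleaving_iff:
  "b \<in> interleaving n X \<longleftrightarrow> (\<forall>i<n. (\<lambda>j. b (i + j * n)) \<in> X i)"
proof
  assume "b \<in> interleaving n X"
  then obtain x where x: "\<forall>i<n. x i \<in> X i" "\<forall>i<n. \<forall>j. b (i + j * n) = x i j"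
    by (auto simp: interleaving_def is_interleaving_def)
  then have "(\<lambda>j. b (i + j * n)) = x i" if "i < n" for i
    using that by auto
  with x(1) show "\<forall>i<n. (\<lambda>j. b (i + j * n)) \<in> X i" by simp
next
  assume "\<forall>i<n. (\<lambda>j. b (i + j * n)) \<in> X i"
  then show "b \<in> interleaving n X"
    unfolding interleaving_def is_interleaving_def
    by (intro CollectI exI[of _ "\<lambda>i j. b (i + j * n)"]) simp
qed

text \<open>Division with remainder by \<open>n\<close>: \<open>i\<close> is the remainder and
  \<open>j\<close> the quotient of \<open>k\<close>.\<close>

lemma all_less_mult_iff:
  fixes m n :: nat
  shows "(\<forall>k<m * n. P k) \<longleftrightarrow> (\<forall>i<n. \<forall>j<m. P (i + j * n))"
proof (intro iffI allI impI)
  fix i j assume P: "\<forall>k<m * n. P k" and "i < n" "j < m"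
  have "i + j * n < Suc j * n" using \<open>i < n\<close> by simp
  also have "\<dots> \<le> m * n" using \<open>j < m\<close> by (intro mult_le_mono1) simp
  finally show "P (i + j * n)" using P by simp
next
  fix k assume P: "\<forall>i<n. \<forall>j<m. P (i + j * n)" and k: "k < m * n"
  then have "0 < n" by (cases n) simp_all
  then have "P (k mod n + k div n * n)"
    using P k by (simp only: mod_less_divisor less_mult_imp_div_less)
  then show "P k" by (simp only: mod_div_mult_eq)
qed

theorem proposition2p9:
  fixes A :: "'a set" and m n :: nat and X :: "nat \<Rightarrow> (nat \<Rightarrow> 'a) set"
  assumes "finite A" and "m \<ge> 2" and "n \<ge> 2"
    and "\<And>k. k < m * n \<Longrightarrow> X k \<subseteq> (UNIV \<rightarrow> A)"
  shows "interleaving n (\<lambda>i. interleaving m (\<lambda>j. X (i + j * n))) = interleaving (m * n) X"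
proof (rule set_eqI)
  fix b
  \<comment> \<open>Left: the position in \<open>b\<close> of term \<open>l\<close> of the inner
    component \<open>j\<close> of the outer component \<open>i\<close>. Right: that of term
    \<open>l\<close> of component \<open>i + j * n\<close> in the \<open>m * n\<close>-fold
    interleaving.\<close>
  have "i + (j + l * m) * n = i + j * n + l * (m * n)" for i j l
    by (simp add: algebra_simps)
  then show "b \<in> interleaving n (\<lambda>i. interleaving m (\<lambda>j. X (i + j * n)))
      \<longleftrightarrow> b \<in> interleaving (m * n) X"
    by (simp only: mem_interleaving_iff all_less_mult_iff)
qed

end
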